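(* Let $n\ge 2$ and let $P_n$ be the metric lattice of partitions of $\{1,\dots,n\}$, and let $\Sigma_n\subseteq P_n$ be the set of singular partitions. For every $x\in P_n$, $$d(x,\Sigma_n)\le 48\,\sup_{y\in P_n}\varphi(x,y),$$ where $d(x,\Sigma_n)=\inf_{y\in\Sigma_n}d(x,y)$ and $$\varphi(x,y):=\inf_{z\in P_n}\max\bigl\{(|x|+|y|)\mathbin{\dot-}(|x+y|+|z|),\ d(x+z,x),\ d(y+z,y)\bigr\}.$$
   Context: $P_n$ is the set of partitions of $\{1,\dots,n\}$ ordered by refinement: $x\le y$ iff every block of $x$ is contained in a block of $y$. $x+y$ denotes the join (least upper bound). $\# x$ is the number of blocks of $x$. The minimal element $0$ is the partition into singletons. The metric is $d(x,y)=\frac{\#x+\#y-2\#(x+y)}{n-1}$, and $|x|:=d(x,0)=\frac{n-\#x}{n-1}$. A partition is singular if at most one of its blocks has two or more elements. For real numbers, $a\mathbin{\dot-}b:=\max\{a-b,0\}$. *)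

theory Defs
  imports Complex_Main "HOL-Library.Disjoint_Sets" "HOL-Algebra.Lattice"
begin

definition partition_lattice :: "nat \<Rightarrow> nat set set gorder" where
  "partition_lattice n =
     \<lparr>carrier = {x. partition_on {1..n} x}, eq = (=), le = refines {1..n}\<rparr>"

definition pzero :: "nat \<Rightarrow> nat set set" where
  "pzero n = (\<lambda>i. {i}) ` {1..n}"

definition pdist :: "nat \<Rightarrow> nat set set \<Rightarrow> nat set set \<Rightarrow> real" where
  "pdist n x y =
     (real (card x) + real (card y) - 2 * real (card (x \<squnion>\<^bsub>partition_lattice n\<^esub> y))) / (real n - 1)"

definition pnorm :: "nat \<Rightarrow> nat set set \<Rightarrow> real" where
  "pnorm n x = pdist n x (pzero n)"

definition singular_partitions :: "nat \<Rightarrow> nat set set set" where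
  "singular_partitions n =
     {x \<in> carrier (partition_lattice n). card {B \<in> x. 2 \<le> card B} \<le> 1}"

definition pdist_set :: "nat \<Rightarrow> nat set set \<Rightarrow> nat set set set \<Rightarrow> real" where
  "pdist_set n x S = (INF y\<in>S. pdist n x y)"

definition truncated_diff :: "real \<Rightarrow> real \<Rightarrow> real" where
  "truncated_diff a b = max (a - b) 0"

definition phi :: "nat \<Rightarrow> nat set set \<Rightarrow> nat set set \<Rightarrow> real" where
  "phi n x y =
     (INF z\<in>carrier (partition_lattice n).
        Max {truncated_diff (pnorm n x + pnorm n y)
               (pnorm n (x \<squnion>\<^bsub>partition_lattice n\<^esub> y) + pnorm n z),
             pdist n (x \<squnion>\<^bsub>partition_lattice n\<^esub> z) x,
             pdist n (y \<squnion>\<^bsub>partition_lattice n\<^esub> z) y})"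

text \<open>
  The library's join is a Hilbert choice of a least upper bound; the following facts show that
  joins exist, so that it denotes the least upper bound, and that \<^const>\<open>pzero\<close> is the minimum.
\<close>

lemma partition_lattice_simps [simp]:
  "carrier (partition_lattice n) = {x. partition_on {1..n} x}"
  "eq (partition_lattice n) = (=)"
  "le (partition_lattice n) = refines {1..n}"
  by (simp_all add: partition_lattice_def)

lemma partition_on_join_exists:
  assumes x: "partition_on A x" and y: "partition_on A y"
  shows "\<exists>j. refines A x j \<and> refines A y j \<and> (\<forall>u. refines A x u \<and> refines A y u \<longrightarrow> refines A j u)"
proof -
  let ?U = "{u. refines A x u \<and> refines A y u}"
  let ?r = "\<lambda>P. {(a, b). \<exists>p\<in>P. a \<in> p \<and> b \<in> p}"
  let ?R = "(?r x \<union> ?r y)\<^sup>+"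
  let ?j = "A // ?R"
  have sub: "?r x \<union> ?r y \<subseteq> A \<times> A"
    using x y by (auto simp: partition_on_def)
  have "equiv A ?R"
  proof (rule equivI)
    show "?R \<subseteq> A \<times> A" using sub by (rule trancl_subset_Sigma)
    show "refl_on A ?R"
      using equiv_partition_on[OF x]
      by (auto simp: equiv_def refl_on_def intro!: r_into_trancl)
    show "sym ?R"
      by (rule sym_trancl) (auto simp: sym_def)
  qed simp
  then have eq: "equiv A ?R" .
  have pj: "partition_on A ?j" by (rule partition_on_quotient[OF eq])
  have ub: "refines A P ?j" if P: "partition_on A P" and PR: "?r P \<subseteq> ?R" for P
    unfolding refines_def
  proof (intro conjI ballI P pj)
    fix B assume B: "B \<in> P"
    then have "B \<noteq> {}" "B \<subseteq> A" using P by (auto simp: partition_on_def)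
    then obtain a where a: "a \<in> B" "a \<in> A" by blast
    have "B \<subseteq> ?R `` {a}" using a B PR by auto
    then show "\<exists>Y\<in>?j. B \<subseteq> Y" using a by (meson quotientI)
  qed
  have least: "refines A ?j u" if u: "refines A x u" "refines A y u" for u
    unfolding refines_def
  proof (intro conjI ballI pj)
    show pu: "partition_on A u" using u by (simp add: refines_def)
    have "?r P \<subseteq> ?r u" if "refines A P u" for P
      using that unfolding refines_def by blast
    then have "?r x \<union> ?r y \<subseteq> ?r u" using u by (meson Un_least)
    moreover have tr: "trans (?r u)" using equiv_partition_on[OF pu] by (simp add: equiv_def)
    ultimately have "?R \<subseteq> (?r u)\<^sup>+" by (meson subsetI trancl_mono)
    then have sub: "?R \<subseteq> ?r u" using tr by (simp add: trancl_id)
    fix B assume "B \<in> ?j"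
    then obtain a where a: "a \<in> A" "B = ?R `` {a}" by (auto elim: quotientE)
    then have B: "B \<subseteq> ?r u `` {a}" using sub by blast
    have "?r u `` {a} \<in> A // ?r u" using a(1) by (rule quotientI)
    then show "\<exists>Y\<in>u. B \<subseteq> Y" using B partition_on_eq_quotient[OF pu] by auto
  qed
  have "refines A x ?j" by (rule ub[OF x]) auto
  moreover have "refines A y ?j" by (rule ub[OF y]) auto
  ultimately show ?thesis using least by blast
qed

lemma lattice_partition_lattice: "Lattice.lattice (partition_lattice n)"
proof (unfold_locales, goal_cases)
  case (9 x y)
  then have xy: "partition_on {1..n} x" "partition_on {1..n} y" by auto
  from partition_on_join_exists[OF xy] obtain j where
    j: "refines {1..n} x j" "refines {1..n} y j"
       "\<And>u. refines {1..n} x u \<Longrightarrow> refines {1..n} y u \<Longrightarrow> refines {1..n} j u"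
    by blast
  moreover have "partition_on {1..n} j" using j(1) by (simp add: refines_def)
  ultimately have "least (partition_lattice n) j (Upper (partition_lattice n) {x, y})"
    using xy by (auto simp: least_def Upper_def)
  then show ?case ..
next
  case (10 x y)
  then have xy: "\<And>P. P \<in> {x, y} \<Longrightarrow> partition_on {1..n} P" by auto
  let ?m = "common_refinement {x, y}"
  have "refines {1..n} ?m x" "refines {1..n} ?m y"
    by (rule refines_common_refinement[OF xy]; simp)+
  moreover have "refines {1..n} u ?m" if "refines {1..n} u x" "refines {1..n} u y" for u
    by (rule common_refinement_coarsest[OF xy]) (use that in \<open>auto simp: refines_def\<close>)
  moreover have "partition_on {1..n} ?m"
    by (rule partition_on_common_refinement[OF xy]) simp_all
  ultimately have "greatest (partition_lattice n) ?m (Lower (partition_lattice n) {x, y})"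
    using xy by (auto simp: greatest_def Lower_def)
  then show ?case ..
qed (auto simp: refines_refl dest: refines_asym intro: refines_trans)

lemma pzero_le:
  assumes "partition_on {1..n} x"
  shows "refines {1..n} (pzero n) x"
  unfolding refines_def
proof (intro conjI ballI assms)
  show "partition_on {1..n} (pzero n)"
    unfolding pzero_def by (rule partition_on_singletons)
  fix B assume "B \<in> pzero n"
  then obtain i where "i \<in> {1..n}" "B = {i}" by (auto simp: pzero_def)
  then show "\<exists>Y\<in>x. B \<subseteq> Y" using partition_onD1[OF assms] by auto
qed

lemma pnorm_eq:
  assumes x: "partition_on {1..n} x"
  shows "pnorm n x = (real n - real (card x)) / (real n - 1)"
proof -
  let ?L = "partition_lattice n"
  interpret L: Lattice.lattice ?L by (rule lattice_partition_lattice)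
  have z: "pzero n \<in> carrier ?L" and x': "x \<in> carrier ?L"
    using x partition_on_singletons[of "{1..n}"] by (auto simp: pzero_def)
  have "least ?L x (Upper ?L {x, pzero n})"
    using x z pzero_le[OF x] by (auto simp: least_def Upper_def refines_refl)
  then have "x \<squnion>\<^bsub>?L\<^esub> pzero n = x"
    using L.joinI[OF _ x' z, where P = "\<lambda>l. l = x"] L.least_unique by blast
  moreover have "card (pzero n) = n"
    by (simp add: pzero_def card_image)
  ultimately show ?thesis by (simp add: pnorm_def pdist_def)
qed

end

theory Submission
  imports Defs
begin

text \<open>
  Write \<open>r(x) = n - #x\<close> for the rank and let \<open>k\<close> be the number of blocks of \<open>x\<close> with at least
  two elements. Merging these \<open>k\<close> blocks into one gives a singular partition, so the distance of
  \<open>x\<close> from the singular partitions is at most \<open>(k - 1)/(n - 1)\<close> (\<open>pdist_set_singular_le\<close>). It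
  remains to find one \<open>y\<close> for which \<open>\<phi>(x, y)\<close> is at least a constant times \<open>k/(n - 1)\<close>.

  Take \<open>\<kappa> = k div 2\<close> disjoint pairs of nontrivial blocks of \<open>x\<close>. In each nontrivial block \<open>B\<close>
  choose two points \<open>p(B) \<noteq> q(B)\<close>, and for each pair \<open>{B, B'}\<close> let \<open>{p(B), p(B')}\<close> and
  \<open>{q(B), q(B')}\<close> be blocks of \<open>y\<close>, the other blocks of \<open>y\<close> being singletons
  (\<open>obtain_transversal_pairs\<close>). Then \<open>r(y) = 2\<kappa>\<close>, while joining \<open>y\<close> to \<open>x\<close> only merges \<open>B\<close>
  with \<open>B'\<close> in each pair, so \<open>r(x + y) \<le> r(x) + \<kappa>\<close>. Hence \<open>r(x) + r(y) - r(x + y) \<ge> \<kappa>\<close>, although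
  blocks of \<open>x\<close> and of \<open>y\<close> share at most one point.

  Suppose that all three terms of \<open>\<phi>(x, y)\<close> are at most \<open>K/(n - 1)\<close> for some \<open>z\<close>. The first
  one forces \<open>r(z) \<ge> \<kappa> - K\<close>. The other two say that joining \<open>z\<close> to \<open>x\<close>, or to \<open>y\<close>, lowers the
  number of blocks by at most \<open>K\<close>, so that at most \<open>2K\<close> blocks of each are changed at all. A block
  of \<open>z\<close> that meets an unchanged block lies inside it; so a point at which both the block of \<open>x\<close>
  and the block of \<open>y\<close> are unchanged is a singleton of \<open>z\<close>. As the blocks of \<open>y\<close> are small and
  as each block of \<open>x\<close> has at most two points in the nontrivial blocks of \<open>y\<close>, only \<open>8K\<close> points
  remain on which \<open>z\<close> can be nontrivial (\<open>small_changes_small_rank\<close>). Therefore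
  \<open>\<kappa> - K \<le> r(z) \<le> 8K\<close>, that is \<open>\<kappa> \<le> 9K\<close>, and \<open>k - 1 \<le> 2\<kappa> \<le> 18K\<close>. The pairs are local: a cheap
  change of \<open>y\<close> can create a common refinement only near few of them, which would fail if all
  the points \<open>p(B)\<close> were joined into one block and all the points \<open>q(B)\<close> into another.
\<close>

section \<open>Coarsening partitions of a finite set\<close>

lemma refines_block_subset:
  assumes "refines A x y" "B \<in> x" "C \<in> y" "e \<in> B" "e \<in> C"
  shows "B \<subseteq> C"
proof -
  obtain D where D: "D \<in> y" "B \<subseteq> D" using assms by (auto simp: refines_def)
  have "disjoint y" using assms by (simp add: refines_def partition_on_def)
  then have "D = C" using D assms unfolding disjoint_def by blast
  then show ?thesis using D by simp
qed

text \<open>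
  A block of \<open>w\<close> that is not a block of \<open>y\<close> is a union of at least two blocks of \<open>y\<close>, all of
  which are lost. So at least half of the lost blocks show up as a drop in the number of blocks,
  and a small drop means that few blocks change.
\<close>
lemma refines_card_changed_blocks:
  assumes fin: "finite A" and r: "refines A y w"
  shows "card (y - w) + 2 * card w \<le> 2 * card y"
proof -
  have py: "partition_on A y" and pw: "partition_on A w" using r by (auto simp: refines_def)
  have fy: "finite y" and fw: "finite w" using fin py pw by (auto intro: finite_elements)
  define S where "S = (\<lambda>C. {B \<in> y. B \<subseteq> C})"
  have two: "2 \<le> card (S C)" if C: "C \<in> w - y" for C
  proof (rule ccontr)
    assume "\<not> 2 \<le> card (S C)"
    moreover have fS: "finite (S C)" using fy by (simp add: S_def)
    ultimately have one: "\<And>B B'. B \<in> S C \<Longrightarrow> B' \<in> S C \<Longrightarrow> B = B'"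
      by (metis One_nat_def Suc_1 card_le_Suc0_iff_eq not_less_eq_eq)
    obtain a where a: "a \<in> C" using C pw by (metis DiffD1 all_not_in_conv partition_onD3)
    have cov: "\<exists>B \<in> S C. e \<in> B" if e: "e \<in> C" for e
    proof -
      have "e \<in> A" using e C pw by (auto simp: partition_on_def)
      then obtain B where B: "B \<in> y" "e \<in> B" using py by (auto simp: partition_on_def)
      then have "B \<subseteq> C" using refines_block_subset[OF r] C e by blast
      then show ?thesis using B by (auto simp: S_def)
    qed
    obtain B where B: "B \<in> S C" using cov a by blast
    have "C \<subseteq> B" using cov one B by blast
    then have "C = B" using B by (auto simp: S_def)
    then show False using B C by (auto simp: S_def)
  qed
  have disj: "S C \<inter> S D = {}" if "C \<in> w" "D \<in> w" "C \<noteq> D" for C D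
  proof -
    have "C \<inter> D = {}" using that pw unfolding partition_on_def disjoint_def by blast
    moreover have "{} \<notin> y" using py by (rule partition_onD3)
    moreover have "B \<subseteq> C \<inter> D" "B \<in> y" if "B \<in> S C \<inter> S D" for B
      using that by (auto simp: S_def)
    ultimately show ?thesis by (metis ex_in_conv subset_empty)
  qed
  have "2 * card (w - y) \<le> (\<Sum>C\<in>w - y. card (S C))"
    using two sum_mono[of "w - y" "\<lambda>_. 2" "\<lambda>C. card (S C)"] by simp
  also have "\<dots> = card (\<Union>C\<in>w - y. S C)"
    by (rule card_UN_disjoint[symmetric]) (use fw fy disj in \<open>auto simp: S_def\<close>)
  also have "\<dots> \<le> card (y - w)"
  proof (rule card_mono)
    show "(\<Union>C\<in>w - y. S C) \<subseteq> y - w"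
    proof
      fix B assume "B \<in> (\<Union>C\<in>w - y. S C)"
      then obtain C where C: "C \<in> w" "C \<notin> y" "B \<in> y" "B \<subseteq> C" by (auto simp: S_def)
      have "B \<noteq> {}" using C(3) partition_onD3[OF py] by auto
      moreover have "B \<inter> C = {}" if "B \<in> w"
        using disjointD[OF partition_onD2[OF pw] that C(1)] C by auto
      ultimately have "B \<notin> w" using C(4) by blast
      then show "B \<in> y - w" using C by simp
    qed
  qed (use fy in simp)
  finally have "2 * card (w - y) \<le> card (y - w)" .
  moreover have "card y = card (y - w) + card (y \<inter> w)"
    using card_Int_Diff[OF fy, of w] by simp
  moreover have "card w = card (w - y) + card (y \<inter> w)"
    using card_Int_Diff[OF fw, of y] by (simp add: Int_commute)
  ultimately show ?thesis by linarith
qed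

lemma refines_card_le:
  assumes "finite A" "refines A y w"
  shows "card w \<le> card y"
  using refines_card_changed_blocks[OF assms] by linarith

text \<open>
  This serves at two levels: on points, to fill up a disjoint family of sets by singletons, and with
  the blocks of a partition in place of the points, where \<open>Y\<close> lists the groups of blocks that are
  going to be merged.
\<close>
definition complete_partition :: "'a set \<Rightarrow> 'a set set \<Rightarrow> 'a set set" where
  "complete_partition A Y = Y \<union> (\<lambda>a. {a}) ` (A - \<Union>Y)"

lemma partition_on_complete_partition:
  assumes "disjoint Y" "{} \<notin> Y" "\<Union>Y \<subseteq> A"
  shows "partition_on A (complete_partition A Y)"
proof (rule partition_onI)
  show "disjnt p q" if "p \<in> complete_partition A Y" "q \<in> complete_partition A Y" "p \<noteq> q" for p q
    using that assms(1) unfolding complete_partition_def disjnt_def disjoint_def by blast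
qed (use assms in \<open>auto simp: complete_partition_def\<close>)

lemma card_complete_partition:
  assumes "finite A" "\<Union>Y \<subseteq> A"
  shows "card (complete_partition A Y) = card Y + card (A - \<Union>Y)"
proof -
  have "finite Y" using assms by (meson finite_UnionD finite_subset)
  then show ?thesis unfolding complete_partition_def
    by (subst card_Un_disjoint) (use assms in \<open>auto simp: card_image\<close>)
qed

text \<open>
  Partitioning the set of blocks of \<open>x\<close> and taking unions is the general way to coarsen \<open>x\<close>; it
  produces both the nearby singular partition and the upper bound for \<open>x + y\<close>.
\<close>
lemma merge_blocks:
  assumes x: "partition_on A x" and C: "partition_on x C"
  shows "refines A x (Union ` C)" "card (Union ` C) = card C"
proof -
  have d: "b = b'" if "b \<in> x" "b' \<in> x" "e \<in> b" "e \<in> b'" for b b' e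
    using that x unfolding partition_on_def disjoint_def by blast
  have cx: "c \<subseteq> x" if "c \<in> C" for c using C that by (auto simp: partition_on_def)
  have dC: "c = c'" if "c \<in> C" "c' \<in> C" "b \<in> c" "b \<in> c'" for b c c'
    using that C unfolding partition_on_def disjoint_def by blast
  have key: "c = c'" if c: "c \<in> C" "c' \<in> C" and e: "e \<in> \<Union>c" "e \<in> \<Union>c'" for c c' e
  proof -
    obtain b b' where b: "b \<in> c" "e \<in> b" "b' \<in> c'" "e \<in> b'" using e by blast
    then have "b = b'" using d[of b b' e] cx c by blast
    then show ?thesis using dC[of c c' b] c b by simp
  qed
  have ne: "\<exists>e. e \<in> \<Union>c" if c: "c \<in> C" for c
  proof -
    obtain b where b: "b \<in> c" using c C by (metis all_not_in_conv partition_onD3)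
    then have "b \<noteq> {}" using cx[OF c] partition_onD3[OF x] by auto
    then show ?thesis using b by blast
  qed
  have "partition_on A (Union ` C)"
  proof (rule partition_onI)
    show "\<Union> (Union ` C) = A" using x C by (auto simp: partition_on_def)
    show "disjnt p q" if "p \<in> Union ` C" "q \<in> Union ` C" "p \<noteq> q" for p q
      using that key unfolding disjnt_def by blast
    show "{} \<notin> Union ` C"
    proof
      assume "{} \<in> Union ` C"
      then obtain c where "c \<in> C" "\<Union>c = {}" by (metis imageE)
      then show False using ne by blast
    qed
  qed
  moreover have "\<exists>Y\<in>Union ` C. B \<subseteq> Y" if "B \<in> x" for B
    using that C by (auto simp: partition_on_def)
  ultimately show "refines A x (Union ` C)" using x by (simp add: refines_def)
  have "inj_on Union C" using key ne by (metis inj_onI)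
  then show "card (Union ` C) = card C" by (rule card_image)
qed

lemma card_Union_pairs:
  assumes "disjoint F" "\<And>c. c \<in> F \<Longrightarrow> card c = 2"
  shows "card (\<Union>F) = 2 * card F"
proof -
  have "finite c" if "c \<in> F" for c
    using assms(2)[OF that] by (metis card.infinite zero_neq_numeral)
  then have "card (\<Union>F) = (\<Sum>c\<in>F. card c)"
    using assms(1) by (intro card_Union_disjoint) (auto simp: disjoint_def pairwise_def disjnt_def)
  then show ?thesis using assms(2) by simp
qed

lemma exists_matching:
  assumes "finite S"
  shows "\<exists>M. disjoint M \<and> (\<forall>c\<in>M. c \<subseteq> S \<and> card c = 2) \<and> card M = card S div 2"
  using assms
proof (induction "card S" arbitrary: S rule: less_induct)
  case less
  show ?case
  proof (cases "card S \<le> 1")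
    case True
    then show ?thesis by (intro exI[of _ "{}"]) (auto simp: disjoint_def)
  next
    case False
    then obtain c where c: "c \<subseteq> S" "card c = 2"
      using obtain_subset_with_card_n[of 2 S] by auto
    have fc: "finite c" using c by (metis card.infinite zero_neq_numeral)
    have cd: "card (S - c) = card S - 2" using c fc by (simp add: card_Diff_subset)
    then obtain M where M: "disjoint M" "\<forall>d\<in>M. d \<subseteq> S - c \<and> card d = 2"
        "card M = card (S - c) div 2"
      using less.hyps[of "S - c"] less.prems False by auto
    have "M \<subseteq> Pow S" using M(2) by auto
    then have fM: "finite M" using less.prems by (meson finite_Pow_iff finite_subset)
    have "c \<noteq> {}" using c by auto
    then have "c \<notin> M" using M(2) by blast
    then have "card (insert c M) = card S div 2" using fM M(3) cd False by simp
    moreover have "disjoint (insert c M)" using M(1,2) unfolding disjoint_def by blast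
    ultimately show ?thesis using M(2) c by (intro exI[of _ "insert c M"]) auto
  qed
qed

section \<open>Joins in the partition lattice\<close>

lemma partition_join:
  assumes x: "partition_on {1..n} x" and y: "partition_on {1..n} y"
  shows "refines {1..n} x (x \<squnion>\<^bsub>partition_lattice n\<^esub> y)"
    and "refines {1..n} y (x \<squnion>\<^bsub>partition_lattice n\<^esub> y)"
    and "refines {1..n} x u \<Longrightarrow> refines {1..n} y u \<Longrightarrow> refines {1..n} (x \<squnion>\<^bsub>partition_lattice n\<^esub> y) u"
proof -
  interpret L: Lattice.lattice "partition_lattice n" by (rule lattice_partition_lattice)
  have c: "x \<in> carrier (partition_lattice n)" "y \<in> carrier (partition_lattice n)"
    using x y by simp_all
  show "refines {1..n} x (x \<squnion>\<^bsub>partition_lattice n\<^esub> y)" using L.join_left[OF c] by simp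
  show "refines {1..n} y (x \<squnion>\<^bsub>partition_lattice n\<^esub> y)" using L.join_right[OF c] by simp
  assume u: "refines {1..n} x u" "refines {1..n} y u"
  then have "u \<in> carrier (partition_lattice n)" by (simp add: refines_def)
  then show "refines {1..n} (x \<squnion>\<^bsub>partition_lattice n\<^esub> y) u"
    using L.join_le[of x u y] u c by simp
qed

lemma partition_on_join:
  assumes "partition_on {1..n} x" "partition_on {1..n} y"
  shows "partition_on {1..n} (x \<squnion>\<^bsub>partition_lattice n\<^esub> y)"
  using partition_join(1)[OF assms] by (simp add: refines_def)

lemma join_absorb:
  assumes "refines {1..n} x y"
  shows "x \<squnion>\<^bsub>partition_lattice n\<^esub> y = y" "y \<squnion>\<^bsub>partition_lattice n\<^esub> x = y"
proof -
  have p: "partition_on {1..n} x" "partition_on {1..n} y" using assms by (auto simp: refines_def)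
  show "x \<squnion>\<^bsub>partition_lattice n\<^esub> y = y"
    using partition_join[OF p] assms p by (meson refines_asym refines_refl)
  show "y \<squnion>\<^bsub>partition_lattice n\<^esub> x = y"
    using partition_join[OF p(2,1)] assms p by (meson refines_asym refines_refl)
qed

lemma pdist_refines:
  assumes "refines {1..n} x y"
  shows "pdist n x y = (real (card x) - real (card y)) / (real n - 1)"
    and "pdist n y x = (real (card x) - real (card y)) / (real n - 1)"
  using join_absorb[OF assms] by (simp_all add: pdist_def)

lemma finite_partition_carrier: "finite (carrier (partition_lattice n))"
proof -
  have "carrier (partition_lattice n) \<subseteq> Pow (Pow {1..n})" by (auto simp: partition_on_def)
  then show ?thesis by (rule finite_subset) simp
qed

section \<open>The distance to the singular partitions\<close>

text \<open>
  Merging all blocks with at least two elements costs one block fewer than there are such blocks.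
  If there are none, \<open>x\<close> is the partition into singletons, and the truncated subtraction of
  natural numbers gives the correct bound \<open>0\<close>.
\<close>
lemma pdist_set_singular_le:
  assumes n: "2 \<le> n" and x: "partition_on {1..n} x"
  shows "pdist_set n x (singular_partitions n)
           \<le> real (card {B \<in> x. 2 \<le> card B} - 1) / (real n - 1)"
proof -
  define S where "S = {B \<in> x. 2 \<le> card B}"
  \<comment> \<open>The empty group is removed because it would merge to an empty block.\<close>
  define C where "C = complete_partition x ({S} - {{}})"
  define s where "s = Union ` C"
  have fx: "finite x" using x by (auto intro: finite_elements)
  have fS: "finite S" "S \<subseteq> x" using fx by (auto simp: S_def)
  have C: "partition_on x C" unfolding C_def
    by (rule partition_on_complete_partition) (use fS in \<open>auto simp: disjoint_def\<close>)
  have US: "\<Union>({S} - {{}}) = S" by auto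
  have "card C = card ({S} - {{}}) + card (x - S)"
    unfolding C_def using card_complete_partition[of x "{S} - {{}}"] fx fS by (simp only: US)
  moreover have "card (x - S) = card x - card S" "card S \<le> card x"
    using fx fS by (auto simp: card_Diff_subset card_mono)
  ultimately have cC: "card x - card C \<le> card S - 1" "card C \<le> card x"
    using fS by (cases "S = {}"; cases "card S"; auto)+
  have r: "refines {1..n} x s" and cs: "card s = card C"
    unfolding s_def using merge_blocks[OF x C] by auto
  have "{B \<in> s. 2 \<le> card B} \<subseteq> {\<Union>S}"
  proof
    fix B assume B: "B \<in> {B \<in> s. 2 \<le> card B}"
    then consider "B = \<Union>S" | b where "b \<in> x - S" "B = b"
      unfolding s_def C_def complete_partition_def US by auto
    then show "B \<in> {\<Union>S}" using B by cases (auto simp: S_def)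
  qed
  then have "card {B \<in> s. 2 \<le> card B} \<le> card {\<Union>S}" by (rule card_mono[rotated]) simp
  then have s: "s \<in> singular_partitions n"
    using r by (simp add: singular_partitions_def refines_def)
  have "finite (singular_partitions n)"
    using finite_partition_carrier[of n] by (simp add: singular_partitions_def)
  then have "pdist_set n x (singular_partitions n) \<le> pdist n x s"
    unfolding pdist_set_def using s by (intro cINF_lower bdd_below_finite) auto
  also have "\<dots> \<le> real (card S - 1) / (real n - 1)"
    unfolding pdist_refines(1)[OF r] using cC cs n by (intro divide_right_mono) auto
  finally show ?thesis by (simp add: S_def)
qed

section \<open>A partition without an approximate meet\<close>

lemma card_Union_le:
  assumes "finite F" "\<And>B. B \<in> F \<Longrightarrow> card B \<le> m"
  shows "card (\<Union>F) \<le> m * card F"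
proof -
  have "card (\<Union>F) \<le> (\<Sum>B\<in>F. card B)"
    using assms(1) by (metis card_Union_le_sum_card)
  also have "\<dots> \<le> (\<Sum>B\<in>F. m)" by (rule sum_mono) (rule assms(2))
  finally show ?thesis by (simp add: mult.commute)
qed

text \<open>The blocks with fewer than two elements cover at most \<open>card z\<close> points.\<close>
lemma rank_le_card_nontrivial:
  assumes A: "finite A" and z: "partition_on A z"
  shows "card A \<le> card z + card (\<Union>{B \<in> z. 2 \<le> card B})"
proof -
  let ?T = "\<Union>{B \<in> z. 2 \<le> card B}" and ?U = "{B \<in> z. card B < 2}"
  have fz: "finite z" using A z by (rule finite_elements)
  have "z = {B \<in> z. 2 \<le> card B} \<union> ?U" by auto
  then have "A = ?T \<union> \<Union>?U" using partition_onD1[OF z] by (metis Union_Un_distrib)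
  then have "card A \<le> card ?T + card (\<Union>?U)" by (metis card_Un_le)
  also have "card (\<Union>?U) \<le> 1 * card ?U" by (rule card_Union_le) (use fz in auto)
  also have "card ?U \<le> card z" using fz by (intro card_mono) auto
  finally show ?thesis by simp
qed

text \<open>
  The partitions \<open>v\<close> and \<open>w\<close> stand for \<open>x + z\<close> and \<open>y + z\<close>: the rank of \<open>z\<close> is at most four times
  the total number of blocks lost by joining \<open>z\<close> to \<open>x\<close> and to \<open>y\<close>. The factor four arises since
  the changed blocks number at most twice the lost ones and each contributes at most two points
  on which \<open>z\<close> is nontrivial.
\<close>
lemma small_changes_small_rank:
  assumes A: "finite A"
    and xv: "refines A x v" and zv: "refines A z v"
    and yw: "refines A y w" and zw: "refines A z w"
    and y: "y = complete_partition A Y" "\<Union>Y \<subseteq> A"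
    and Y2: "\<forall>b\<in>Y. card b = 2"
    and x2: "\<forall>c\<in>x. card (c \<inter> \<Union>Y) \<le> 2"
    and xY: "\<forall>c\<in>x. \<forall>b\<in>Y. \<forall>e\<in>b \<inter> c. \<forall>e'\<in>b \<inter> c. e = e'"
  shows "card A + 4 * card v + 4 * card w \<le> card z + 4 * card x + 4 * card y"
proof -
  have px: "partition_on A x" and py: "partition_on A y" and pz: "partition_on A z"
    using xv yw zv by (auto simp: refines_def)
  have fx: "finite x" and fy: "finite y" using A px py by (auto intro: finite_elements)
  define T where "T = \<Union>{B \<in> z. 2 \<le> card B}"
  define Q where "Q = (\<lambda>c. c \<inter> \<Union>Y) ` (x - v)"
  \<comment> \<open>A point of a nontrivial block of \<open>z\<close> lies in a changed block of \<open>y\<close>, or else in a pair and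
    in a changed block of \<open>x\<close>.\<close>
  have "T \<subseteq> \<Union>(y - w) \<union> \<Union>Q"
  proof
    fix e assume "e \<in> T"
    then obtain B where B: "B \<in> z" "2 \<le> card B" "e \<in> B" by (auto simp: T_def)
    have eA: "e \<in> A" using B pz by (auto simp: partition_on_def)
    obtain b where b: "b \<in> y" "e \<in> b" using eA py by (auto simp: partition_on_def)
    obtain c where c: "c \<in> x" "e \<in> c" using eA px by (auto simp: partition_on_def)
    have "\<exists>e'\<in>B. e' \<noteq> e"
    proof (rule ccontr)
      assume "\<not> ?thesis"
      then have "B \<subseteq> {e}" by auto
      then have "card B \<le> card {e}" by (rule card_mono[rotated]) simp
      then show False using B by simp
    qed
    then obtain e' where e': "e' \<in> B" "e' \<noteq> e" by blast
    show "e \<in> \<Union>(y - w) \<union> \<Union>Q"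
    proof (cases "b \<in> w")
      case False
      then show ?thesis using b by blast
    next
      case True
      then have Bb: "B \<subseteq> b" using refines_block_subset[OF zw] B b by blast
      \<comment> \<open>Otherwise \<open>b\<close> would be a singleton containing both \<open>e\<close> and \<open>e'\<close>.\<close>
      then have bY: "b \<in> Y" using b y e' by (auto simp: complete_partition_def)
      have "c \<notin> v"
      proof
        assume "c \<in> v"
        then have "B \<subseteq> c" using refines_block_subset[OF zv] B c by blast
        then show False using xY c(1) bY Bb e' B by blast
      qed
      then show ?thesis using b c bY by (auto simp: Q_def)
    qed
  qed
  then have "card T \<le> card (\<Union>(y - w) \<union> \<Union>Q)"
  proof (rule card_mono[rotated])
    have "\<Union>(y - w) \<union> \<Union>Q \<subseteq> A"
      using partition_onD1[OF px] partition_onD1[OF py] by (auto simp: Q_def)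
    then show "finite (\<Union>(y - w) \<union> \<Union>Q)" using A by (rule finite_subset)
  qed
  also have "\<dots> \<le> card (\<Union>(y - w)) + card (\<Union>Q)" by (rule card_Un_le)
  also have "card (\<Union>(y - w)) \<le> 2 * card (y - w)"
    by (rule card_Union_le) (use fy Y2 y in \<open>auto simp: complete_partition_def\<close>)
  also have "card (\<Union>Q) \<le> 2 * card Q"
    by (rule card_Union_le) (use fx x2 in \<open>auto simp: Q_def\<close>)
  also have "card Q \<le> card (x - v)" unfolding Q_def by (rule card_image_le) (use fx in simp)
  finally have "card T \<le> 2 * card (y - w) + 2 * card (x - v)" by simp
  moreover have "card A \<le> card z + card T"
    unfolding T_def by (rule rank_le_card_nontrivial[OF A pz])
  ultimately show ?thesis
    using refines_card_changed_blocks[OF A xv] refines_card_changed_blocks[OF A yw] by linarith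
qed

text \<open>
  The pairs of points joined by \<open>y\<close>. Both the \<open>p\<close>-points and the \<open>q\<close>-points of two matched blocks
  are joined, so within the matched blocks \<open>y\<close> performs every merger of blocks of \<open>x\<close> twice. This
  redundancy is the failure of modularity: \<open>y\<close> has twice the rank that it adds to \<open>x\<close>. The
  partition \<open>u\<close> merges matched blocks and bounds the join from above.
\<close>
lemma obtain_transversal_pairs:
  assumes A: "finite A" and x: "partition_on A x"
  obtains Y where "disjoint Y" "\<Union>Y \<subseteq> A" "\<forall>b\<in>Y. card b = 2" "\<forall>c\<in>x. card (c \<inter> \<Union>Y) \<le> 2"
    "\<forall>c\<in>x. \<forall>b\<in>Y. \<forall>e\<in>b \<inter> c. \<forall>e'\<in>b \<inter> c. e = e'"
    "card Y = 2 * (card {B \<in> x. 2 \<le> card B} div 2)"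
    "\<exists>u. refines A x u \<and> refines A (complete_partition A Y) u \<and>
        card u + card {B \<in> x. 2 \<le> card B} div 2 = card x"
proof -
  define S where "S = {B \<in> x. 2 \<le> card B}"
  have fx: "finite x" using A x by (rule finite_elements)
  then have fS: "finite S" and Sx: "S \<subseteq> x" by (auto simp: S_def)
  obtain M where M: "disjoint M" "\<And>c. c \<in> M \<Longrightarrow> c \<subseteq> S" "\<And>c. c \<in> M \<Longrightarrow> card c = 2"
      "card M = card S div 2"
    using exists_matching[OF fS] by blast
  have "\<exists>p q. p \<in> B \<and> q \<in> B \<and> p \<noteq> q" if "B \<in> S" for B
  proof -
    have "2 \<le> card B" using that by (simp add: S_def)
    then obtain D where "D \<subseteq> B" "card D = 2" by (meson obtain_subset_with_card_n)
    then show ?thesis by (auto simp: card_2_iff)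
  qed
  then obtain p q where pq: "\<And>B. B \<in> S \<Longrightarrow> p B \<in> B" "\<And>B. B \<in> S \<Longrightarrow> q B \<in> B"
      "\<And>B. B \<in> S \<Longrightarrow> p B \<noteq> q B" by metis
  have d: "B = B'" if "B \<in> x" "B' \<in> x" "e \<in> B" "e \<in> B'" for B B' e
    using that x unfolding partition_on_def disjoint_def by blast
  have dS: "B = B'" if "B \<in> S" "B' \<in> S" "e \<in> B" "e \<in> B'" for B B' e
    using that d Sx by blast
  have pp: "p B = p B' \<Longrightarrow> B = B'" and qq: "q B = q B' \<Longrightarrow> B = B'" and npq: "p B \<noteq> q B'"
    if "B \<in> S" "B' \<in> S" for B B'
    using that pq dS by metis+
  have ip: "inj_on p S" and iq: "inj_on q S" using pp qq by (auto simp: inj_on_def)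
  define Y where "Y = (`) p ` M \<union> (`) q ` M"
  have MS: "\<Union>M \<subseteq> S" using M(2) by blast
  have fM: "finite M" using M(2) fS by (meson PowI finite_Pow_iff finite_subset subsetI)
  have UY: "\<Union>Y = p ` \<Union>M \<union> q ` \<Union>M" by (auto simp: Y_def)
  have cM: "c = c'" if "c \<in> M" "c' \<in> M" "B \<in> c" "B \<in> c'" for c c' B
    using that M(1) unfolding disjoint_def by blast
  have Mne: "\<exists>B. B \<in> c" if "c \<in> M" for c using M(3)[OF that] by (metis all_not_in_conv card.empty zero_neq_numeral)
  have Y2: "card b = 2" if b: "b \<in> Y" for b
  proof -
    obtain c where c: "c \<in> M" "b = p ` c \<or> b = q ` c" using b by (auto simp: Y_def)
    then show ?thesis
      using M(2,3)[OF c(1)] ip iq by (metis card_image inj_on_subset)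
  qed
  have dY: "disjoint Y"
  proof (rule disjointI)
    fix a b assume ab: "a \<in> Y" "b \<in> Y" "a \<noteq> b"
    show "a \<inter> b = {}"
    proof (rule ccontr)
      assume "a \<inter> b \<noteq> {}"
      then obtain e where e: "e \<in> a" "e \<in> b" by blast
      obtain c where c: "c \<in> M" "a = p ` c \<or> a = q ` c" using ab by (auto simp: Y_def)
      obtain c' where c': "c' \<in> M" "b = p ` c' \<or> b = q ` c'" using ab by (auto simp: Y_def)
      have cS: "c \<subseteq> S" "c' \<subseteq> S" using M(2) c c' by auto
      from c(2) c'(2) show False
      proof (elim disjE)
        assume *: "a = p ` c" "b = p ` c'"
        then have "c = c'" using e cS pp cM[OF c(1) c'(1)] by blast
        then show False using * ab by simp
      next
        assume *: "a = q ` c" "b = q ` c'"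
        then have "c = c'" using e cS qq cM[OF c(1) c'(1)] by blast
        then show False using * ab by simp
      qed (use e cS npq in \<open>force+\<close>)
    qed
  qed
  have YA: "\<Union>Y \<subseteq> A"
  proof -
    have "\<Union>S \<subseteq> A" using Sx x by (auto simp: partition_on_def)
    then show ?thesis unfolding UY using MS pq by blast
  qed
  have "card (c \<inter> \<Union>Y) \<le> 2" if c: "c \<in> x" for c
  proof -
    have "c \<inter> \<Union>Y \<subseteq> {p c, q c}"
    proof
      fix e assume e: "e \<in> c \<inter> \<Union>Y"
      then obtain B where B: "B \<in> S" "e = p B \<or> e = q B" unfolding UY using MS by blast
      then have "e \<in> B" using pq by auto
      then have "B = c" using d[of B c e] B c e Sx by blast
      then show "e \<in> {p c, q c}" using B by auto
    qed
    then have "card (c \<inter> \<Union>Y) \<le> card {p c, q c}" by (rule card_mono[rotated]) simp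
    also have "\<dots> \<le> 2" by (simp add: card_insert_if)
    finally show ?thesis .
  qed
  moreover have "e = e'" if c: "c \<in> x" and b: "b \<in> Y" and e: "e \<in> b \<inter> c" "e' \<in> b \<inter> c" for c b e e'
  proof -
    obtain m where m: "m \<in> M" "b = p ` m \<or> b = q ` m" using b by (auto simp: Y_def)
    have mS: "m \<subseteq> S" using M(2) m by auto
    have "B = c" if "B \<in> m" "p B \<in> c \<or> q B \<in> c" for B
      using that mS pq(1,2)[of B] d[of B c] c Sx by blast
    then show ?thesis using e m(2) by blast
  qed
  moreover have "card Y = 2 * (card S div 2)"
  proof -
    have i1: "inj_on ((`) p) M" using ip M(2) by (metis inj_onI inj_on_image_eq_iff)
    have i2: "inj_on ((`) q) M" using iq M(2) by (metis inj_onI inj_on_image_eq_iff)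
    have "(`) p ` M \<inter> (`) q ` M = {}"
    proof (rule ccontr)
      assume "\<not> ?thesis"
      then obtain c c' where cc: "c \<in> M" "c' \<in> M" "p ` c = q ` c'" by blast
      obtain B where B: "B \<in> c" using Mne cc by blast
      then have "p B \<in> q ` c'" using cc by blast
      then obtain B' where "B' \<in> c'" "p B = q B'" by blast
      then show False using npq B M(2) cc by blast
    qed
    then show ?thesis
      unfolding Y_def using fM M(4) by (simp add: card_Un_disjoint card_image[OF i1] card_image[OF i2])
  qed
  moreover have "\<exists>u. refines A x u \<and> refines A (complete_partition A Y) u \<and>
        card u + card S div 2 = card x"
  proof -
    define C where "C = complete_partition x M"
    define u where "u = Union ` C"
    have "{} \<notin> M" using Mne by blast
    then have C: "partition_on x C" unfolding C_def
      by (intro partition_on_complete_partition) (use M MS Sx in auto)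
    have "card (\<Union>M) = 2 * card M" by (rule card_Union_pairs[OF M(1,3)])
    moreover have "\<Union>M \<subseteq> x" using MS Sx by blast
    moreover have "card (\<Union>M) \<le> card x" using \<open>\<Union>M \<subseteq> x\<close> fx by (intro card_mono)
    moreover have "card C = card M + card (x - \<Union>M)"
      unfolding C_def by (rule card_complete_partition) fact+
    ultimately have "card C + card M = card x"
      using fx by (simp add: card_Diff_subset finite_subset[OF _ fx])
    then have cu: "card u + card S div 2 = card x"
      using merge_blocks(2)[OF x C] M(4) by (simp add: u_def)
    have r: "refines A x u" unfolding u_def by (rule merge_blocks(1)[OF x C])
    have pu: "partition_on A u" using r by (simp add: refines_def)
    have "{} \<notin> Y" using Y2 by (metis card.empty zero_neq_numeral)
    then have py: "partition_on A (complete_partition A Y)"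
      by (intro partition_on_complete_partition dY YA)
    have "\<exists>D\<in>u. b \<subseteq> D" if b: "b \<in> complete_partition A Y" for b
    proof (cases "b \<in> Y")
      case True
      then obtain c where c: "c \<in> M" "b = p ` c \<or> b = q ` c" by (auto simp: Y_def)
      then have "b \<subseteq> \<Union>c" using M(2)[OF c(1)] pq by blast
      moreover have "\<Union>c \<in> u" using c by (auto simp: u_def C_def complete_partition_def)
      ultimately show ?thesis by blast
    next
      case False
      then obtain a where "a \<in> A" "b = {a}" using b by (auto simp: complete_partition_def)
      then show ?thesis using pu by (auto simp: partition_on_def)
    qed
    then have "refines A (complete_partition A Y) u" using py pu by (simp add: refines_def)
    then show ?thesis using r cu by blast
  qed
  ultimately show thesis using dY YA Y2 that[of Y] unfolding S_def by blast
qed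

text \<open>
  The bound on the rank of \<open>z\<close>, applied with \<open>v = x + z\<close> and \<open>w = y + z\<close>, contributes \<open>4 + 4\<close>, and
  the first term of \<open>\<phi>\<close> contributes one more, to the constant nine.
\<close>
lemma exists_phi_ge:
  assumes n: "2 \<le> n" and x: "partition_on {1..n} x"
  shows "\<exists>y. partition_on {1..n} y \<and>
    real (card {B \<in> x. 2 \<le> card B} div 2) / (9 * (real n - 1)) \<le> phi n x y"
proof -
  let ?A = "{1..n}" and ?L = "partition_lattice n"
  define k where "k = card {B \<in> x. 2 \<le> card B} div 2"
  obtain Y where Y: "disjoint Y" "\<Union>Y \<subseteq> ?A" "\<forall>b\<in>Y. card b = 2" "\<forall>c\<in>x. card (c \<inter> \<Union>Y) \<le> 2"
    "\<forall>c\<in>x. \<forall>b\<in>Y. \<forall>e\<in>b \<inter> c. \<forall>e'\<in>b \<inter> c. e = e'"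
    "card Y = 2 * k"
    "\<exists>u. refines ?A x u \<and> refines ?A (complete_partition ?A Y) u \<and> card u + k = card x"
    using obtain_transversal_pairs[OF finite_atLeastAtMost x] unfolding k_def by blast
  define y where "y = complete_partition ?A Y"
  obtain u where u: "refines ?A x u" "refines ?A y u" "card u + k = card x"
    using Y(7) by (auto simp: y_def)
  have y: "partition_on ?A y" using u by (simp add: refines_def)
  have "card y + 2 * k = n"
  proof -
    have "card (\<Union>Y) = 2 * card Y" using Y(1,3) by (intro card_Union_pairs) auto
    moreover have "card (\<Union>Y) \<le> n" using card_mono[OF _ Y(2)] by simp
    moreover have "card (?A - \<Union>Y) = n - card (\<Union>Y)"
      using Y(2) by (simp add: card_Diff_subset finite_subset[OF Y(2)])
    ultimately show ?thesis
      using card_complete_partition[of ?A Y] Y(2,6) by (simp add: y_def)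
  qed
  then have cy: "real (card y) = real n - 2 * real k" by linarith
  have cxy: "real (card x) - real k \<le> real (card (x \<squnion>\<^bsub>?L\<^esub> y))"
    using refines_card_le[OF _ partition_join(3)[OF x y u(1,2)]] u(3) by simp
  have N: "0 < real n - 1" using n by simp
  have "real k / (9 * (real n - 1)) \<le> phi n x y"
    unfolding phi_def
  proof (rule cINF_greatest)
    show "carrier ?L \<noteq> {}" using x by auto
    fix z assume "z \<in> carrier ?L"
    then have z: "partition_on ?A z" by simp
    define m where "m = Max {truncated_diff (pnorm n x + pnorm n y)
               (pnorm n (x \<squnion>\<^bsub>?L\<^esub> y) + pnorm n z),
             pdist n (x \<squnion>\<^bsub>?L\<^esub> z) x, pdist n (y \<squnion>\<^bsub>?L\<^esub> z) y}"
    have "pnorm n x + pnorm n y - (pnorm n (x \<squnion>\<^bsub>?L\<^esub> y) + pnorm n z) \<le> m"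
      and m2: "pdist n (x \<squnion>\<^bsub>?L\<^esub> z) x \<le> m" and m3: "pdist n (y \<squnion>\<^bsub>?L\<^esub> z) y \<le> m"
      by (auto simp: m_def truncated_diff_def)
    then have "(real (card (x \<squnion>\<^bsub>?L\<^esub> y)) + real (card z) - real (card x) - real (card y)) / (real n - 1) \<le> m"
      unfolding pnorm_eq[OF x] pnorm_eq[OF y] pnorm_eq[OF z] pnorm_eq[OF partition_on_join[OF x y]]
      by (simp add: add_divide_distrib diff_divide_distrib)
    then have 1: "real (card (x \<squnion>\<^bsub>?L\<^esub> y)) + real (card z) - real (card x) - real (card y) \<le> m * (real n - 1)"
      using N by (simp add: divide_le_eq)
    have 2: "real (card x) - real (card (x \<squnion>\<^bsub>?L\<^esub> z)) \<le> m * (real n - 1)"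
      using m2 N unfolding pdist_refines(2)[OF partition_join(1)[OF x z]] by (simp add: divide_le_eq)
    have 3: "real (card y) - real (card (y \<squnion>\<^bsub>?L\<^esub> z)) \<le> m * (real n - 1)"
      using m3 N unfolding pdist_refines(2)[OF partition_join(1)[OF y z]] by (simp add: divide_le_eq)
    have "card ?A + 4 * card (x \<squnion>\<^bsub>?L\<^esub> z) + 4 * card (y \<squnion>\<^bsub>?L\<^esub> z)
        \<le> card z + 4 * card x + 4 * card y"
      by (rule small_changes_small_rank[OF _ partition_join(1,2)[OF x z] partition_join(1,2)[OF y z] y_def])
        (use Y in auto)
    then have "real n + 4 * real (card (x \<squnion>\<^bsub>?L\<^esub> z)) + 4 * real (card (y \<squnion>\<^bsub>?L\<^esub> z))
        \<le> real (card z) + 4 * real (card x) + 4 * real (card y)" by simp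
    then have "real k \<le> 9 * (m * (real n - 1))" using 1 2 3 cxy cy by linarith
    then show "real k / (9 * (real n - 1)) \<le> m"
      using N by (simp add: divide_le_eq mult_ac)
  qed
  then show ?thesis using y unfolding k_def by blast
qed

theorem proposition6p5:
  fixes n :: nat and x :: "nat set set"
  assumes "n \<ge> 2"
    and "x \<in> carrier (partition_lattice n)"
  shows "pdist_set n x (singular_partitions n)
           \<le> 48 * (SUP y\<in>carrier (partition_lattice n). phi n x y)"
proof -
  have x: "partition_on {1..n} x" using assms by simp
  have N: "0 < real n - 1" using assms by simp
  let ?k = "card {B \<in> x. 2 \<le> card B}"
  obtain y where y: "partition_on {1..n} y" "real (?k div 2) / (9 * (real n - 1)) \<le> phi n x y"
    using exists_phi_ge[OF assms(1) x] by blast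
  have "phi n x y \<le> (SUP y\<in>carrier (partition_lattice n). phi n x y)"
    using y finite_partition_carrier by (intro cSUP_upper bdd_above_finite) auto
  then have le: "real (?k div 2) / (9 * (real n - 1)) \<le> (SUP y\<in>carrier (partition_lattice n). phi n x y)"
    using y by linarith
  \<comment> \<open>Already \<open>18 = 2 * 9\<close> would do, since \<open>k - 1 \<le> 2 * (k div 2)\<close>.\<close>
  have "real (?k - 1) \<le> 48 / 9 * real (?k div 2)" by linarith
  then have "real (?k - 1) / (real n - 1) \<le> 48 / 9 * real (?k div 2) / (real n - 1)"
    using N by (intro divide_right_mono) auto
  also have "\<dots> = 48 * (real (?k div 2) / (9 * (real n - 1)))" using N by (simp add: field_simps)
  finally show ?thesis
    using pdist_set_singular_le[OF assms(1) x] le by linarith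
qed

end
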